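(* Let $X$ be a metric space, let $\mathcal S\subset\mathcal P(X)$ be a nonempty class, let $\zeta:\mathcal S\to[0,+\infty]$ be a gauge and let $A\subset X$ be nonempty. Let $\mu$ be a measure over $X$, let $t>0$ and assume: (1) $\mu$ is a regular measure. (2) $\mathcal S_{\mu,\zeta}$ covers $A$ finely. (3) For every $x\in A$ we have $F^\zeta(\mu,x)<t$. Then $\mu(E)\le t\,\psi_\zeta(E)$ for all $E\subset A$.
   Context: A "measure over $X$" is an outer measure defined on all subsets of $X$; measurability is in the sense of Carathéodory. A measure $\mu$ over $X$ is regular if every $E\subset X$ is contained in a $\mu$-measurable set $E'$ with $\mu(E')=\mu(E)$. A gauge is a function $\zeta:\mathcal S\to[0,+\infty]$ on a nonempty class $\mathcal S\subset\mathcal P(X)$. Convention: $\operatorname{diam}(\emptyset)=0$. Carathéodory measure: for $\delta>0$ and $R\subset X$, $\phi_{\zeta,\delta}(R)=\inf\sum_j\zeta(E_j)$, the infimum being over all countable (possibly finite) families $\{E_j\}\subset\mathcal S$ covering $R$ with $\operatorname{diam}(E_j)\le\delta$ for all $j$ ($\inf\emptyset=+\infty$); $\psi_\zeta(R)=\sup_{\delta>0}\phi_{\zeta,\delta}(R)$. A family $\mathcal G\subset\mathcal P(X)$ covers $A$ finely if for every $a\in A$ and $\epsilon>0$ there is $S\in\mathcal G$ with $a\in S$ and $\operatorname{diam}(S)<\epsilon$. $\mathcal S_{\mu,\zeta}=\mathcal S\setminus\{S\in\mathcal S:\ \zeta(S)=\mu(S)=0\ \text{or}\ \mu(S)=\zeta(S)=+\infty\}$.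 The quotient function $Q_{\mu,\zeta}:\mathcal S_{\mu,\zeta}\to[0,+\infty]$ is $Q_{\mu,\zeta}(S)=+\infty$ if $\zeta(S)=0$, $Q_{\mu,\zeta}(S)=\mu(S)/\zeta(S)$ if $0<\zeta(S)<+\infty$, and $Q_{\mu,\zeta}(S)=0$ if $\zeta(S)=+\infty$. If for every $\epsilon>0$ some $S\in\mathcal S_{\mu,\zeta}$ satisfies $x\in S$ and $\operatorname{diam}(S)<\epsilon$, the Federer density of $\mu$ at $x$ is $$F^\zeta(\mu,x)=\inf_{\epsilon>0}\sup\{Q_{\mu,\zeta}(S): S\in\mathcal S_{\mu,\zeta},\ x\in S,\ \operatorname{diam}(S)<\epsilon\}.$$ *)

theory Defs
  imports "HOL-Analysis.Analysis"
begin

text \<open>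
  The ambient metric space is the whole type. A measure over it is an outer measure defined on all
  subsets, that is \<^term>\<open>outer_measure_space UNIV \<mu>\<close>, where the \<^const>\<open>UNIV\<close> is the class of all
  subsets. The library states countable subadditivity for disjoint sequences only; together with
  monotonicity on all subsets this is the usual condition for arbitrary sequences.
\<close>

definition caratheodory_measurable :: "('a set \<Rightarrow> ennreal) \<Rightarrow> 'a set \<Rightarrow> bool" where
  "caratheodory_measurable \<mu> E \<longleftrightarrow> E \<in> lambda_system UNIV UNIV \<mu>"

definition regular_outer_measure :: "('a set \<Rightarrow> ennreal) \<Rightarrow> bool" where
  "regular_outer_measure \<mu> \<longleftrightarrow>
     outer_measure_space UNIV \<mu> \<and>
     (\<forall>E. \<exists>E'. E \<subseteq> E' \<and> caratheodory_measurable \<mu> E' \<and> \<mu> E' = \<mu> E)"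

text \<open>
  The library's real-valued \<^const>\<open>diameter\<close> is unspecified on unbounded sets; here they get
  infinite diameter. The supremum over no pairs gives the empty set diameter 0.
\<close>

definition ediam :: "'a::metric_space set \<Rightarrow> ennreal" where
  "ediam S = (SUP (x, y) \<in> S \<times> S. ennreal (dist x y))"

text \<open>
  A gauge on a class \<open>\<S>\<close> is represented by a total function \<open>\<zeta>\<close>; only its values on \<open>\<S>\<close> are used.
\<close>

definition caratheodory_approx ::
  "'a::metric_space set set \<Rightarrow> ('a set \<Rightarrow> ennreal) \<Rightarrow> real \<Rightarrow> 'a set \<Rightarrow> ennreal" where
  "caratheodory_approx \<S> \<zeta> \<delta> R =
     Inf {(\<Sum>\<^sub>\<infinity>j\<in>J. \<zeta> (E j)) | (J :: nat set) (E :: nat \<Rightarrow> 'a set).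
            (\<forall>j\<in>J. E j \<in> \<S> \<and> ediam (E j) \<le> ennreal \<delta>) \<and> R \<subseteq> (\<Union>j\<in>J. E j)}"

definition caratheodory_measure ::
  "'a::metric_space set set \<Rightarrow> ('a set \<Rightarrow> ennreal) \<Rightarrow> 'a set \<Rightarrow> ennreal" where
  "caratheodory_measure \<S> \<zeta> R = (SUP \<delta>\<in>{0<..}. caratheodory_approx \<S> \<zeta> \<delta> R)"

definition covers_finely :: "'a::metric_space set set \<Rightarrow> 'a set \<Rightarrow> bool" where
  "covers_finely \<G> A \<longleftrightarrow>
     (\<forall>a\<in>A. \<forall>\<epsilon>::real. \<epsilon> > 0 \<longrightarrow> (\<exists>S\<in>\<G>. a \<in> S \<and> ediam S < ennreal \<epsilon>))"

definition quotient_class ::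
  "'a set set \<Rightarrow> ('a set \<Rightarrow> ennreal) \<Rightarrow> ('a set \<Rightarrow> ennreal) \<Rightarrow> 'a set set" where
  "quotient_class \<S> \<mu> \<zeta> =
     \<S> - {S \<in> \<S>. (\<zeta> S = 0 \<and> \<mu> S = 0) \<or> (\<mu> S = \<infinity> \<and> \<zeta> S = \<infinity>)}"

definition quotient_fun ::
  "('a set \<Rightarrow> ennreal) \<Rightarrow> ('a set \<Rightarrow> ennreal) \<Rightarrow> 'a set \<Rightarrow> ennreal" where
  "quotient_fun \<mu> \<zeta> S =
     (if \<zeta> S = 0 then \<infinity> else if \<zeta> S = \<infinity> then 0 else \<mu> S / \<zeta> S)"

text \<open>
  Meaningful only at points that lie in members of \<^term>\<open>quotient_class \<S> \<mu> \<zeta>\<close> of arbitrarily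
  small diameter; elsewhere the formula gives 0, the supremum of the empty set.
\<close>

definition federer_density ::
  "'a::metric_space set set \<Rightarrow> ('a set \<Rightarrow> ennreal) \<Rightarrow> ('a set \<Rightarrow> ennreal) \<Rightarrow> 'a \<Rightarrow> ennreal" where
  "federer_density \<S> \<zeta> \<mu> x =
     (INF \<epsilon>\<in>{0::real<..}.
        Sup (quotient_fun \<mu> \<zeta> `
               {S \<in> quotient_class \<S> \<mu> \<zeta>. x \<in> S \<and> ediam S < ennreal \<epsilon>}))"

end

theory Submission
  imports Defs
begin

text \<open>
  Split \<open>E\<close> into the increasing sequence of the sets \<open>E\<^sub>n\<close> of points \<open>x\<close> such that the quotient is at
  most \<open>t\<close> on all members of the quotient class that contain \<open>x\<close> and have diameter below
  \<open>1 / (n + 1)\<close>; by the density hypothesis they exhaust \<open>E\<close>. In a cover of \<open>E\<^sub>n\<close> by small sets only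
  those meeting \<open>E\<^sub>n\<close> matter, and each of these satisfies \<open>\<mu> S \<le> t * \<zeta> S\<close>: by definition of
  \<open>E\<^sub>n\<close> if it is in the quotient class, and trivially if it is one of the excluded sets. Summation
  bounds \<open>\<mu> E\<^sub>n\<close>, and regularity makes \<open>\<mu>\<close> continuous along the increasing sequence.
\<close>

lemma ennreal_divide_le_iff:
  fixes a b c :: ennreal
  assumes "b \<noteq> 0" "b < top"
  shows "a / b \<le> c \<longleftrightarrow> a \<le> b * c"
proof
  assume "a / b \<le> c"
  then have "b * (a / b) \<le> b * c" by (intro mult_left_mono) auto
  then show "a \<le> b * c"
    using assms by (simp add: ennreal_times_divide mult.commute[of b a] mult_divide_eq_ennreal)
qed (use assms in \<open>simp add: divide_le_posI_ennreal zero_less_iff_neq_zero\<close>)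

lemma outer_measure_mono:
  fixes \<mu> :: "'a set \<Rightarrow> ennreal"
  assumes "outer_measure_space UNIV \<mu>" "A \<subseteq> B"
  shows "\<mu> A \<le> \<mu> B"
  using assms by (auto simp: outer_measure_space_def increasing_def)

text \<open>Disjointing the sequence keeps its union and shrinks each member, so subadditivity for
  disjoint sequences and monotonicity suffice.\<close>

lemma outer_measure_UN_le:
  fixes \<mu> :: "'a set \<Rightarrow> ennreal" and A :: "nat \<Rightarrow> 'a set"
  assumes oms: "outer_measure_space UNIV \<mu>"
  shows "\<mu> (\<Union>i. A i) \<le> (\<Sum>i. \<mu> (A i))"
proof -
  have "\<mu> (\<Union>i. A i) = \<mu> (\<Union>i. disjointed A i)"
    by (simp add: UN_disjointed_eq)
  also have "\<dots> \<le> (\<Sum>i. \<mu> (disjointed A i))"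
    using oms disjoint_family_disjointed[of A]
    by (auto simp: outer_measure_space_def countably_subadditive_def)
  also have "\<dots> \<le> (\<Sum>i. \<mu> (A i))"
    by (intro suminf_le outer_measure_mono[OF oms] disjointed_subset) auto
  finally show ?thesis .
qed

text \<open>Padding the family with empty sets, which have measure 0, reduces an arbitrary index set
  to a full sequence. The form matches the sums in \<open>caratheodory_approx\<close>.\<close>

lemma outer_measure_UN_le_infsum:
  fixes \<mu> :: "'a set \<Rightarrow> ennreal" and J :: "nat set"
  assumes oms: "outer_measure_space UNIV \<mu>"
  shows "\<mu> (\<Union>j\<in>J. E j) \<le> (\<Sum>\<^sub>\<infinity>j\<in>J. \<mu> (E j))"
proof -
  define F where "F j = (if j \<in> J then E j else {})" for j
  have empty: "\<mu> {} = 0"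
    using oms by (simp add: outer_measure_space_def positive_def)
  have "\<mu> (\<Union>j\<in>J. E j) = \<mu> (\<Union>j. F j)"
    by (rule arg_cong[of _ _ \<mu>]) (auto simp: F_def split: if_splits)
  also have "\<dots> \<le> (\<Sum>j. \<mu> (F j))"
    by (rule outer_measure_UN_le[OF oms])
  also have "\<dots> = (\<Sum>\<^sub>\<infinity>j. \<mu> (F j))"
    by (intro sums_unique[symmetric] has_sum_imp_sums has_sum_infsum
        nonneg_summable_on_complete) simp
  also have "\<dots> = (\<Sum>\<^sub>\<infinity>j\<in>J. \<mu> (E j))"
    by (rule infsum_cong_neutral) (auto simp: F_def empty)
  finally show ?thesis .
qed

text \<open>Measurable hulls \<open>H n\<close> of the \<open>E n\<close> need not increase, but
  their tail intersections \<open>C n\<close> do. As \<open>C n\<close> lies between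
  \<open>E n\<close> and \<open>H n\<close>, it has the same measure as \<open>E n\<close>, and
  continuity from below on measurable sets applies to \<open>C\<close>.\<close>

lemma regular_outer_measure_incseq:
  assumes reg: "regular_outer_measure \<mu>" and inc: "incseq E"
  shows "\<mu> (\<Union>n. E n) = (SUP n. \<mu> (E n))"
proof (rule antisym)
  have oms: "outer_measure_space UNIV \<mu>"
    using reg by (simp add: regular_outer_measure_def)
  define L where "L = lambda_system UNIV UNIV \<mu>"
  have "sigma_algebra (UNIV :: 'a set) UNIV"
    using sigma_algebra_Pow[of "UNIV :: 'a set"] by simp
  then have ms: "measure_space UNIV L \<mu>"
    unfolding L_def using oms by (rule sigma_algebra.caratheodory_lemma)
  interpret sigma_algebra UNIV L
    using ms by (simp add: measure_space_def)
  have "\<forall>n. \<exists>H. E n \<subseteq> H \<and> H \<in> L \<and> \<mu> H = \<mu> (E n)"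
    using reg unfolding regular_outer_measure_def caratheodory_measurable_def L_def by blast
  then obtain H where H: "\<And>n. E n \<subseteq> H n" "\<And>n. H n \<in> L" "\<And>n. \<mu> (H n) = \<mu> (E n)"
    by metis
  define C where "C n = (\<Inter>k\<in>{n..}. H k)" for n
  have EC: "E n \<subseteq> C n" for n
    using H(1) incseqD[OF inc] by (fastforce simp: C_def)
  have CL: "C n \<in> L" for n
    unfolding C_def using H(2) by (intro countable_INT) auto
  have "incseq C"
    by (auto simp: C_def incseq_def)
  \<comment> \<open>Continuity from below is available for \<open>emeasure\<close>; \<open>M\<close>
    packages \<open>\<mu>\<close> as such a measure, agreeing with it on \<open>L\<close>.\<close>
  define M where "M = measure_of UNIV L \<mu>"
  have sets: "sets M = L"
    by (simp add: M_def sigma_sets_eq)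
  have em: "emeasure M B = \<mu> B" if "B \<in> L" for B
    using ms that unfolding M_def measure_space_def
    by (intro emeasure_measure_of_sigma) auto
  have "\<mu> (\<Union>n. E n) \<le> \<mu> (\<Union>n. C n)"
    using EC by (intro outer_measure_mono[OF oms]) blast
  also have "\<dots> = (SUP n. \<mu> (C n))"
    using SUP_emeasure_incseq[of C M] \<open>incseq C\<close> CL
    by (simp add: sets em image_subset_iff countable_UN)
  also have "\<dots> \<le> (SUP n. \<mu> (E n))"
  proof (rule SUP_mono)
    show "\<exists>m\<in>UNIV. \<mu> (C n) \<le> \<mu> (E m)" for n
      using outer_measure_mono[OF oms, of "C n" "H n"] H(3)[of n] by (auto simp: C_def)
  qed
  finally show "\<mu> (\<Union>n. E n) \<le> (SUP n. \<mu> (E n))" .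
  show "(SUP n. \<mu> (E n)) \<le> \<mu> (\<Union>n. E n)"
    by (intro SUP_least outer_measure_mono[OF oms]) blast
qed

text \<open>
  Members of \<open>\<S>\<close> outside the quotient class satisfy the conclusion as \<open>0 \<le> 0\<close> or \<open>\<infinity> \<le> \<infinity>\<close>.
\<close>

lemma le_mult_gauge:
  assumes "S \<in> \<S>" "t > 0"
    and quot: "S \<in> quotient_class \<S> \<mu> \<zeta> \<Longrightarrow> quotient_fun \<mu> \<zeta> S \<le> ennreal t"
  shows "\<mu> S \<le> ennreal t * \<zeta> S"
proof (cases "S \<in> quotient_class \<S> \<mu> \<zeta>")
  case True
  then have "quotient_fun \<mu> \<zeta> S \<le> ennreal t" by (rule quot)
  \<comment> \<open>If \<open>\<zeta> S = 0\<close>, the quotient is infinite and the bound by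
    \<open>t\<close> is contradictory; if \<open>\<zeta> S = \<infinity>\<close>, the right-hand
    side is infinite because \<open>t > 0\<close>; otherwise multiply by
    \<open>\<zeta> S\<close>.\<close>
  then show ?thesis
    using \<open>t > 0\<close>
    by (auto simp: quotient_fun_def ennreal_mult_top ennreal_divide_le_iff mult.commute
        less_top[symmetric] top_unique split: if_splits)
next
  case False
  then show ?thesis
    using assms(1,2) by (auto simp: quotient_class_def ennreal_mult_top)
qed

lemma outer_measure_le_caratheodory_approx:
  assumes oms: "outer_measure_space UNIV \<mu>" and "t > 0"
    and bound: "\<And>S. S \<in> \<S> \<Longrightarrow> S \<inter> R \<noteq> {} \<Longrightarrow> ediam S \<le> ennreal \<delta> \<Longrightarrow> \<mu> S \<le> ennreal t * \<zeta> S"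
  shows "\<mu> R \<le> ennreal t * caratheodory_approx \<S> \<zeta> \<delta> R"
proof -
  \<comment> \<open>Dividing by \<open>t\<close>, which is positive and finite, leaves the infimum
    alone on the right, so it suffices to bound each covering sum.\<close>
  have "\<mu> R / ennreal t \<le> caratheodory_approx \<S> \<zeta> \<delta> R"
    unfolding caratheodory_approx_def
  proof (rule Inf_greatest, clarify)
    fix J :: "nat set" and E :: "nat \<Rightarrow> 'a set"
    assume E: "\<forall>j\<in>J. E j \<in> \<S> \<and> ediam (E j) \<le> ennreal \<delta>" and cover: "R \<subseteq> (\<Union>j\<in>J. E j)"
    \<comment> \<open>Members of the cover that miss \<open>R\<close> are dropped, since
      \<open>bound\<close> says nothing about them.\<close>
    define J' where "J' = {j \<in> J. E j \<inter> R \<noteq> {}}"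
    have "\<mu> R \<le> \<mu> (\<Union>j\<in>J'. E j)"
      using cover by (intro outer_measure_mono[OF oms]) (fastforce simp: J'_def)
    also have "\<dots> \<le> (\<Sum>\<^sub>\<infinity>j\<in>J'. \<mu> (E j))"
      by (rule outer_measure_UN_le_infsum[OF oms])
    also have "\<dots> \<le> (\<Sum>\<^sub>\<infinity>j\<in>J. ennreal t * \<zeta> (E j))"
      using E by (intro infsum_mono_neutral nonneg_summable_on_complete)
        (auto simp: J'_def intro: bound)
    also have "\<dots> = ennreal t * (\<Sum>\<^sub>\<infinity>j\<in>J. \<zeta> (E j))"
    proof -
      \<comment> \<open>Extension by 0 turns the sum over \<open>J\<close> into a series over all
        naturals, from which the constant factor can be pulled out.\<close>
      define F where "F j = (if j \<in> J then \<zeta> (E j) else 0)" for j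
      have conv: "(\<Sum>j. g j) = (\<Sum>\<^sub>\<infinity>j. g j)" for g :: "nat \<Rightarrow> ennreal"
        by (intro sums_unique[symmetric] has_sum_imp_sums has_sum_infsum
            nonneg_summable_on_complete) simp
      have "(\<Sum>\<^sub>\<infinity>j\<in>J. ennreal t * \<zeta> (E j)) = (\<Sum>\<^sub>\<infinity>j. ennreal t * F j)"
        by (rule infsum_cong_neutral) (auto simp: F_def)
      also have "\<dots> = ennreal t * (\<Sum>\<^sub>\<infinity>j. F j)"
        by (simp flip: conv)
      also have "(\<Sum>\<^sub>\<infinity>j. F j) = (\<Sum>\<^sub>\<infinity>j\<in>J. \<zeta> (E j))"
        by (rule infsum_cong_neutral) (auto simp: F_def)
      finally show ?thesis .
    qed
    finally show "\<mu> R / ennreal t \<le> (\<Sum>\<^sub>\<infinity>j\<in>J. \<zeta> (E j))"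
      using \<open>t > 0\<close> by (simp add: ennreal_divide_le_iff)
  qed
  then show ?thesis
    using \<open>t > 0\<close> by (simp add: ennreal_divide_le_iff)
qed

lemma caratheodory_approx_mono:
  "R \<subseteq> R' \<Longrightarrow> caratheodory_approx \<S> \<zeta> \<delta> R \<le> caratheodory_approx \<S> \<zeta> \<delta> R'"
  unfolding caratheodory_approx_def by (rule Inf_superset_mono) blast

theorem lemma3p1:
  fixes \<S> :: "'a::metric_space set set"
    and \<zeta> \<mu> :: "'a set \<Rightarrow> ennreal"
    and A :: "'a set"
    and t :: real
  assumes "\<S> \<noteq> {}"
    and "A \<noteq> {}"
    and "outer_measure_space UNIV \<mu>"
    and "t > 0"
    and "regular_outer_measure \<mu>"
    and "covers_finely (quotient_class \<S> \<mu> \<zeta>) A"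
    and "\<forall>x\<in>A. federer_density \<S> \<zeta> \<mu> x < ennreal t"
  shows "\<forall>E\<subseteq>A. \<mu> E \<le> ennreal t * caratheodory_measure \<S> \<zeta> E"
proof (intro allI impI)
  fix E assume "E \<subseteq> A"
  define B where "B n = {x \<in> E. \<forall>S\<in>quotient_class \<S> \<mu> \<zeta>.
    x \<in> S \<longrightarrow> ediam S < ennreal (1 / Suc n) \<longrightarrow> quotient_fun \<mu> \<zeta> S \<le> ennreal t}" for n
  have "incseq B"
  proof (rule incseq_SucI)
    fix n
    have "ennreal (1 / Suc (Suc n)) \<le> ennreal (1 / Suc n)"
      by (intro ennreal_leI) (simp add: frac_le)
    then show "B n \<subseteq> B (Suc n)"
      unfolding B_def by (blast intro: less_le_trans)
  qed
  have "E \<subseteq> (\<Union>n. B n)"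
  proof
    fix x assume "x \<in> E"
    then have "federer_density \<S> \<zeta> \<mu> x < ennreal t"
      using assms(7) \<open>E \<subseteq> A\<close> by blast
    \<comment> \<open>The density is an infimum over scales; being strictly below \<open>t\<close>,
      it has some scale whose supremum is already below \<open>t\<close>.\<close>
    then obtain \<epsilon> :: real where "\<epsilon> > 0" and
      \<epsilon>: "Sup (quotient_fun \<mu> \<zeta> ` {S \<in> quotient_class \<S> \<mu> \<zeta>. x \<in> S \<and> ediam S < ennreal \<epsilon>})
        < ennreal t"
      unfolding federer_density_def by (auto simp: INF_less_iff)
    obtain n where "1 / Suc n < \<epsilon>"
      using nat_approx_posE[OF \<open>\<epsilon> > 0\<close>] by blast
    then have n: "ennreal (1 / Suc n) \<le> ennreal \<epsilon>"
      by (intro ennreal_leI) simp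
    have "quotient_fun \<mu> \<zeta> S \<le> ennreal t"
      if "S \<in> quotient_class \<S> \<mu> \<zeta>" "x \<in> S" "ediam S < ennreal (1 / Suc n)" for S
    proof -
      have "ediam S < ennreal \<epsilon>"
        using that(3) n by (rule less_le_trans)
      then show ?thesis
        using that \<epsilon> by (intro order.trans[OF SUP_upper less_imp_le]) auto
    qed
    then show "x \<in> (\<Union>n. B n)"
      using \<open>x \<in> E\<close> by (auto simp: B_def)
  qed
  have "\<mu> (B n) \<le> ennreal t * caratheodory_measure \<S> \<zeta> E" for n
  proof -
    \<comment> \<open>Covers allow diameter equal to \<open>\<delta>\<close>, whereas
      \<open>B n\<close> controls only diameters strictly below \<open>1 / Suc n\<close>; hence the
      next smaller scale.\<close>
    define \<delta> :: real where "\<delta> = 1 / Suc (Suc n)"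
    have "\<delta> > 0" and \<delta>: "ennreal \<delta> < ennreal (1 / Suc n)"
      by (auto simp: \<delta>_def ennreal_less_iff frac_less2)
    have "\<mu> (B n) \<le> ennreal t * caratheodory_approx \<S> \<zeta> \<delta> (B n)"
    proof (rule outer_measure_le_caratheodory_approx[OF assms(3,4)])
      fix S assume S: "S \<in> \<S>" "S \<inter> B n \<noteq> {}" "ediam S \<le> ennreal \<delta>"
      have "ediam S < ennreal (1 / Suc n)"
        using S(3) \<delta> by (rule le_less_trans)
      then show "\<mu> S \<le> ennreal t * \<zeta> S"
        using S(2) by (intro le_mult_gauge[OF S(1) assms(4)]) (auto simp: B_def)
    qed
    \<comment> \<open>Enlarging \<open>B n\<close> to \<open>E\<close> and then taking the supremum
      over scales makes the bound independent of \<open>n\<close>.\<close>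
    also have "\<dots> \<le> ennreal t * caratheodory_approx \<S> \<zeta> \<delta> E"
      by (intro mult_left_mono caratheodory_approx_mono) (auto simp: B_def)
    also have "\<dots> \<le> ennreal t * caratheodory_measure \<S> \<zeta> E"
      unfolding caratheodory_measure_def using \<open>\<delta> > 0\<close>
      by (intro mult_left_mono SUP_upper) auto
    finally show ?thesis .
  qed
  then have "(SUP n. \<mu> (B n)) \<le> ennreal t * caratheodory_measure \<S> \<zeta> E"
    by (rule SUP_least)
  moreover have "\<mu> E \<le> \<mu> (\<Union>n. B n)"
    using \<open>E \<subseteq> (\<Union>n. B n)\<close> by (rule outer_measure_mono[OF assms(3)])
  ultimately show "\<mu> E \<le> ennreal t * caratheodory_measure \<S> \<zeta> E"
    using regular_outer_measure_incseq[OF assms(5) \<open>incseq B\<close>] by simp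
qed

end
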